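(* Let $R$ be a superring. If $(A,\mathfrak p)$ is a valuation pair of $R$, then $A$ is integrally closed in $R$.
   Context: A superring is a $\mathbb Z/2$-graded unital ring $R=R_{\overline 0}\oplus R_{\overline 1}$ with $1\neq 0$, assumed supercommutative: $R_{\overline 0}$ is central in $R$ and every element of $R_{\overline 1}$ squares to zero. A subsuperring $A\subseteq R$ is a subring with the same unit and compatible grading ($A_i=A\cap R_i$). An ideal $\mathfrak p$ of a superring $A$ is prime if $A/\mathfrak p$ is an integral domain; any prime ideal is graded and contains $A_{\overline 1}$; write $\mathfrak p_{\overline 0}=\mathfrak p\cap A_{\overline 0}$. Put $\mathfrak J_R=R\cdot R_{\overline 1}=R_{\overline 1}^2\oplus R_{\overline 1}$. A valuation pair of $R$ is a pair $(A,\mathfrak p)$ such that: (i) $A$ is a subsuperring of $R$ and $\mathfrak p$ is a prime ideal of $A$ containing $\mathfrak J_R$; (ii) for every $x\in R\setminus A$ there exists $x'\in\mathfrak p_{\overline 0}$ with $xx'\in A\setminus\mathfrak p$. Let $A\subseteq R$ be superrings ($A$ a subsuperring of $R$). A homogeneous $x\in R$ is integral over $A$ if there is a finitely generated $A$-supermodule $M=Ax_1+\cdots+Ax_n\subseteq R$ with $1\in M$, where $x_1,\dots,x_n$ are even elements in the center of $R$, such that $xM\subseteq M$. An arbitrary $x\in R$ is integral over $A$ if its homogeneous components are. The integral closure $\mathrm{cl}_R(A)$ is the set of elements of $R$ integral over $A$, and $A$ is integrally closed in $R$ if $A=\mathrm{cl}_R(A)$. *)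

theory Defs
  imports "HOL-Algebra.Algebra"
begin

text \<open>A superring is a ring \<open>R\<close> together with its even part \<open>R0\<close> and its odd part \<open>R1\<close>;
  supercommutativity is included, in the form of the axioms \<open>even_central\<close> and \<open>odd_square\<close>.\<close>

locale superring = ring R for R (structure) +
  fixes R0 R1 :: "'a set"
  assumes even_additive_subgroup: "additive_subgroup R0 R"
    and odd_additive_subgroup: "additive_subgroup R1 R"
    and parts_inter: "R0 \<inter> R1 = {\<zero>}"
    and parts_sum: "R0 <+>\<^bsub>R\<^esub> R1 = carrier R"
    and one_even: "\<one> \<in> R0"
    and even_even_mult: "\<lbrakk>x \<in> R0; y \<in> R0\<rbrakk> \<Longrightarrow> x \<otimes> y \<in> R0"
    and even_odd_mult: "\<lbrakk>x \<in> R0; y \<in> R1\<rbrakk> \<Longrightarrow> x \<otimes> y \<in> R1"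
    and odd_even_mult: "\<lbrakk>x \<in> R1; y \<in> R0\<rbrakk> \<Longrightarrow> x \<otimes> y \<in> R1"
    and odd_odd_mult: "\<lbrakk>x \<in> R1; y \<in> R1\<rbrakk> \<Longrightarrow> x \<otimes> y \<in> R0"
    and one_neq_zero: "\<one> \<noteq> \<zero>"
    and even_central: "\<lbrakk>x \<in> R0; y \<in> carrier R\<rbrakk> \<Longrightarrow> x \<otimes> y = y \<otimes> x"
    and odd_square: "x \<in> R1 \<Longrightarrow> x \<otimes> x = \<zero>"

definition ring_center :: "('a, 'm) ring_scheme \<Rightarrow> 'a set" where
  "ring_center R = {z \<in> carrier R. \<forall>y \<in> carrier R. z \<otimes>\<^bsub>R\<^esub> y = y \<otimes>\<^bsub>R\<^esub> z}"

definition subsuperring ::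
    "('a, 'm) ring_scheme \<Rightarrow> 'a set \<Rightarrow> 'a set \<Rightarrow> 'a set \<Rightarrow> bool" where
  "subsuperring R R0 R1 A \<longleftrightarrow>
     subring A R \<and> superring (R\<lparr>carrier := A\<rparr>) (A \<inter> R0) (A \<inter> R1)"

text \<open>The locale \<open>primeideal\<close> of the library presupposes a commutative ring, so primality is
  expressed through the quotient; commutativity of the quotient is part of \<open>domain\<close>.\<close>

definition super_prime_ideal :: "'a set \<Rightarrow> ('a, 'm) ring_scheme \<Rightarrow> bool" where
  "super_prime_ideal \<pp> A \<longleftrightarrow> ideal \<pp> A \<and> domain (A Quot \<pp>)"

text \<open>\<open>ideal_prod\<close> yields the finite sums of products \<open>r \<otimes> x\<close> with \<open>r \<in> R\<close>, \<open>x \<in> R1\<close>; it does not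
  require its arguments to be ideals.\<close>

definition odd_ideal :: "('a, 'm) ring_scheme \<Rightarrow> 'a set \<Rightarrow> 'a set" where
  "odd_ideal R R1 = ideal_prod R (carrier R) R1"

definition valuation_pair ::
    "('a, 'm) ring_scheme \<Rightarrow> 'a set \<Rightarrow> 'a set \<Rightarrow> 'a set \<Rightarrow> 'a set \<Rightarrow> bool" where
  "valuation_pair R R0 R1 A \<pp> \<longleftrightarrow>
     subsuperring R R0 R1 A \<and>
     super_prime_ideal \<pp> (R\<lparr>carrier := A\<rparr>) \<and>
     odd_ideal R R1 \<subseteq> \<pp> \<and>
     (\<forall>x \<in> carrier R - A. \<exists>x' \<in> \<pp> \<inter> (A \<inter> R0). x \<otimes>\<^bsub>R\<^esub> x' \<in> A - \<pp>)"

definition module_span ::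
    "('a, 'm) ring_scheme \<Rightarrow> 'a set \<Rightarrow> nat \<Rightarrow> (nat \<Rightarrow> 'a) \<Rightarrow> 'a set" where
  "module_span R A n xs =
     {finsum R (\<lambda>i. a i \<otimes>\<^bsub>R\<^esub> xs i) {..<n} | a. a \<in> {..<n} \<rightarrow> A}"

text \<open>Spanned by even elements, \<open>M\<close> below is automatically a graded \<open>A\<close>-submodule of \<open>R\<close>.\<close>

definition homogeneous_integral ::
    "('a, 'm) ring_scheme \<Rightarrow> 'a set \<Rightarrow> 'a set \<Rightarrow> 'a set \<Rightarrow> 'a \<Rightarrow> bool" where
  "homogeneous_integral R R0 R1 A x \<longleftrightarrow>
     x \<in> R0 \<union> R1 \<and>
     (\<exists>n xs M. (\<forall>i<n. xs i \<in> R0 \<inter> ring_center R) \<and>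
        M = module_span R A n xs \<and> \<one>\<^bsub>R\<^esub> \<in> M \<and> (\<forall>m \<in> M. x \<otimes>\<^bsub>R\<^esub> m \<in> M))"

text \<open>In a superring the decomposition \<open>x = x0 \<oplus> x1\<close> exists and is unique, so the existential
  quantifier below refers to the homogeneous components of \<open>x\<close>.\<close>

definition integral_over ::
    "('a, 'm) ring_scheme \<Rightarrow> 'a set \<Rightarrow> 'a set \<Rightarrow> 'a set \<Rightarrow> 'a \<Rightarrow> bool" where
  "integral_over R R0 R1 A x \<longleftrightarrow>
     (\<exists>x0 \<in> R0. \<exists>x1 \<in> R1. x = x0 \<oplus>\<^bsub>R\<^esub> x1 \<and>
        homogeneous_integral R R0 R1 A x0 \<and> homogeneous_integral R R0 R1 A x1)"

definition integral_closure ::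
    "('a, 'm) ring_scheme \<Rightarrow> 'a set \<Rightarrow> 'a set \<Rightarrow> 'a set \<Rightarrow> 'a set" where
  "integral_closure R R0 R1 A = {x \<in> carrier R. integral_over R R0 R1 A x}"

definition integrally_closed ::
    "('a, 'm) ring_scheme \<Rightarrow> 'a set \<Rightarrow> 'a set \<Rightarrow> 'a set \<Rightarrow> bool" where
  "integrally_closed R R0 R1 A \<longleftrightarrow> A = integral_closure R R0 R1 A"

end

theory Submission
  imports Defs
begin

text \<open>
  Let \<open>(A, \<pp>)\<close> be a valuation pair. The odd part of \<open>R\<close> lies in \<open>\<pp>\<close>, hence in \<open>A\<close>, so only even
  integral elements matter. Suppose \<open>x\<close> is even, \<open>x M \<subseteq> M\<close> with \<open>M = A x\<^sub>1 + \<dots> + A x\<^sub>n\<close>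
  containing \<open>\<one>\<close>, and \<open>x \<notin> A\<close>. Choose an even \<open>x' \<in> \<pp>\<close> with \<open>y = x x' \<in> A - \<pp>\<close>. Then
  \<open>y M = x' (x M) \<subseteq> \<pp> M\<close>, so \<open>M\<close> is a finitely generated module that becomes zero after tensoring
  with the residue field of \<open>\<pp>\<close>. Nakayama's lemma (\<open>nakayama_annihilator\<close>) provides an element outside \<open>\<pp>\<close>
  that annihilates \<open>M\<close>; as \<open>\<one> \<in> M\<close>, that element is zero, which is absurd.

  Since the generators of \<open>M\<close> are even, the even part of an expansion over \<open>A\<close> of an even element is an expansion of it
  with even coefficients (\<open>even_mem_span_even\<close>). This moves the argument to the commutative ring
  \<open>A \<inter> R0\<close> and its prime ideal \<open>\<pp> \<inter> R0\<close>, where the usual form of Nakayama's lemma is available.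
\<close>

section \<open>Finitely generated modules and Nakayama's lemma\<close>

lemma module_spanI:
  assumes "a \<in> {..<n} \<rightarrow> A"
  shows "finsum R (\<lambda>i. a i \<otimes>\<^bsub>R\<^esub> xs i) {..<n} \<in> module_span R A n xs"
  using assms unfolding module_span_def by blast

lemma module_spanE:
  assumes "m \<in> module_span R A n xs"
  obtains a where "a \<in> {..<n} \<rightarrow> A" "m = finsum R (\<lambda>i. a i \<otimes>\<^bsub>R\<^esub> xs i) {..<n}"
  using assms unfolding module_span_def by blast

lemma (in ring) generator_mem_span:
  assumes "\<one> \<in> A" "\<zero> \<in> A" and xs: "xs \<in> {..<n} \<rightarrow> carrier R" and "j < n"
  shows "xs j \<in> module_span R A n xs"
proof -
  have "(\<Oplus>i\<in>{..<n}. (if i = j then \<one> else \<zero>) \<otimes> xs i)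
      = (\<Oplus>i\<in>{..<n}. if j = i then xs i else \<zero>)"
    using xs by (intro finsum_cong') (auto simp: Pi_def)
  also have "\<dots> = xs j"
    using xs \<open>j < n\<close> by (intro finsum_singleton) auto
  finally have eq: "(\<Oplus>i\<in>{..<n}. (if i = j then \<one> else \<zero>) \<otimes> xs i) = xs j" .
  have "(\<lambda>i. if i = j then \<one> else \<zero>) \<in> {..<n} \<rightarrow> A"
    using assms by auto
  from module_spanI[OF this, of R xs] show ?thesis
    unfolding eq .
qed

lemma (in ring) annihilates_span:
  assumes xs: "xs \<in> {..<n} \<rightarrow> carrier R" and A: "A \<subseteq> carrier R" and t: "t \<in> carrier R"
    and central: "\<And>y. y \<in> carrier R \<Longrightarrow> t \<otimes> y = y \<otimes> t"
    and kills: "\<And>j. j < n \<Longrightarrow> t \<otimes> xs j = \<zero>"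
    and m: "m \<in> module_span R A n xs"
  shows "t \<otimes> m = \<zero>"
proof -
  obtain a where a: "a \<in> {..<n} \<rightarrow> A" and m_eq: "m = (\<Oplus>i\<in>{..<n}. a i \<otimes> xs i)"
    using m by (rule module_spanE)
  have *: "t \<otimes> (a i \<otimes> xs i) = \<zero>" if i: "i \<in> {..<n}" for i
  proof -
    have ai: "a i \<in> carrier R" and xi: "xs i \<in> carrier R"
      using a A xs i by auto
    have "t \<otimes> (a i \<otimes> xs i) = (a i \<otimes> t) \<otimes> xs i"
      using ai xi t by (simp add: m_assoc[symmetric] central)
    also have "\<dots> = a i \<otimes> (t \<otimes> xs i)"
      using ai xi t by (simp add: m_assoc)
    finally show ?thesis
      using kills[of i] i ai by simp
  qed
  have "t \<otimes> m = (\<Oplus>i\<in>{..<n}. t \<otimes> (a i \<otimes> xs i))"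
    unfolding m_eq using a A xs t by (intro finsum_rdistr) auto
  also have "\<dots> = (\<Oplus>i\<in>{..<n}. \<zero>)"
    using * by (intro finsum_cong') auto
  finally show ?thesis by simp
qed

text \<open>
  This is Nakayama's lemma after localisation at \<open>q\<close>, proved by eliminating one generator at a time
  rather than by a determinant. The relation for the last generator reads
  \<open>(s - c\<^sub>n) x\<^sub>n = \<Sum>i<n. c\<^sub>i x\<^sub>i\<close>, where \<open>u = s - c\<^sub>n\<close> lies outside \<open>q\<close>. Multiplying the other
  relations by \<open>u\<close> expresses \<open>(u s) x\<^sub>j\<close> through the remaining generators, again with coefficients
  in \<open>q\<close>, and \<open>u s\<close> lies outside \<open>q\<close> because \<open>q\<close> is prime.
\<close>

lemma (in ring) nakayama_annihilator:
  assumes B: "subring B R" and q: "primeideal q (R\<lparr>carrier := B\<rparr>)"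
    and central: "\<And>b y. b \<in> B \<Longrightarrow> y \<in> carrier R \<Longrightarrow> b \<otimes> y = y \<otimes> b"
    and xs: "xs \<in> {..<n} \<rightarrow> carrier R"
    and s: "s \<in> B - q" and rel: "\<And>j. j < n \<Longrightarrow> s \<otimes> xs j \<in> module_span R q n xs"
  shows "\<exists>t \<in> B - q. \<forall>j<n. t \<otimes> xs j = \<zero>"
  using xs s rel
proof (induction n arbitrary: s)
  case 0
  then show ?case by auto
next
  case (Suc n)
  interpret q: primeideal q "R\<lparr>carrier := B\<rparr>" by (rule q)
  have Bc: "B \<subseteq> carrier R" and qB: "q \<subseteq> B"
    using subringE(1)[OF B] q.Icarr by auto
  have q_add: "a \<oplus> b \<in> q" if "a \<in> q" "b \<in> q" for a b
    using additive_subgroup.a_closed[OF q.additive_subgroup_axioms that] by simp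
  have q_mult: "a \<otimes> b \<in> q" if "a \<in> B" "b \<in> q" for a b
    using q.I_l_closed[of b a] that by simp
  have q_prime: "a \<otimes> b \<in> B - q" if "a \<in> B - q" "b \<in> B - q" for a b
    using q.I_prime[of a b] that subringE(6)[OF B] by auto
  have xs: "xs i \<in> carrier R" if "i \<le> n" for i
    using Suc.prems(1) that by auto
  have sB: "s \<in> B" and s_c: "s \<in> carrier R"
    using Suc.prems(2) Bc by auto
  have "\<exists>c. c \<in> {..<Suc n} \<rightarrow> q \<and> s \<otimes> xs j = (\<Oplus>i\<in>{..<Suc n}. c i \<otimes> xs i)" if "j \<le> n" for j
    using module_spanE[OF Suc.prems(3)[of j]] that by (metis less_Suc_eq_le)
  then obtain c where cq: "\<And>j. j \<le> n \<Longrightarrow> c j \<in> {..<Suc n} \<rightarrow> q"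
    and sx: "\<And>j. j \<le> n \<Longrightarrow> s \<otimes> xs j = (\<Oplus>i\<in>{..<Suc n}. c j i \<otimes> xs i)"
    by metis
  have c_q: "c j i \<in> q" if "j \<le> n" "i \<le> n" for j i
    using cq[OF that(1)] that(2) by auto
  have c_B: "c j i \<in> B" and c_c: "c j i \<in> carrier R" if "j \<le> n" "i \<le> n" for j i
    using c_q[OF that] qB Bc by auto
  define S where "S j = (\<Oplus>i\<in>{..<n}. c j i \<otimes> xs i)" for j
  have S_c: "S j \<in> carrier R" if "j \<le> n" for j
    unfolding S_def using that c_c xs by (intro finsum_closed) auto
  have sx': "s \<otimes> xs j = c j n \<otimes> xs n \<oplus> S j" if "j \<le> n" for j
    unfolding sx[OF that] S_def lessThan_Suc
    using that c_c xs by (intro finsum_insert) auto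

  define u where "u = s \<ominus> c n n"
  have cn: "c n n \<in> carrier R" "c n n \<in> B" "c n n \<in> q"
    using c_c c_B c_q by auto
  have uB: "u \<in> B"
    unfolding u_def minus_eq using sB cn subringE(5,7)[OF B] by auto
  hence u_c: "u \<in> carrier R"
    using Bc by auto
  have "u \<notin> q"
  proof
    assume "u \<in> q"
    hence "u \<oplus> c n n \<in> q" using cn q_add by auto
    moreover have "u \<oplus> c n n = s"
      unfolding u_def using cn s_c by algebra
    ultimately show False using Suc.prems(2) by auto
  qed
  hence u: "u \<in> B - q"
    using uB by auto
  have ux: "u \<otimes> xs n = S n"
  proof -
    have "u \<otimes> xs n = s \<otimes> xs n \<ominus> c n n \<otimes> xs n"
      unfolding u_def using s_c cn xs[OF order_refl]
      by (simp add: minus_eq l_distr l_minus)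
    also have "\<dots> = (c n n \<otimes> xs n \<oplus> S n) \<ominus> c n n \<otimes> xs n"
      unfolding sx'[OF order_refl] ..
    also have "\<dots> = S n"
      using m_closed[OF cn(1) xs[OF order_refl]] S_c[OF order_refl] by algebra
    finally show ?thesis .
  qed

  have "(u \<otimes> s) \<otimes> xs j \<in> module_span R q n xs" if j: "j < n" for j
  proof -
    have jn: "j \<le> n" using j by simp
    define d where "d i = u \<otimes> c j i \<oplus> c j n \<otimes> c n i" for i
    have d: "d \<in> {..<n} \<rightarrow> q"
      unfolding d_def using c_q c_B jn uB by (auto intro!: q_add q_mult)
    have cjn: "c j n \<in> carrier R" and xn: "xs n \<in> carrier R" and xj: "xs j \<in> carrier R"
      and Sj: "S j \<in> carrier R" and Sn: "S n \<in> carrier R"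
      using c_c xs S_c jn by auto
    have "(u \<otimes> s) \<otimes> xs j = u \<otimes> (c j n \<otimes> xs n \<oplus> S j)"
      unfolding sx'[OF jn, symmetric] using u_c s_c xj by (rule m_assoc)
    also have "\<dots> = (u \<otimes> c j n) \<otimes> xs n \<oplus> u \<otimes> S j"
      using u_c cjn xn Sj by (simp add: r_distr m_assoc)
    also have "(u \<otimes> c j n) \<otimes> xs n = c j n \<otimes> S n"
      unfolding central[OF uB cjn] ux[symmetric] using cjn u_c xn by (rule m_assoc)
    also have "c j n \<otimes> S n \<oplus> u \<otimes> S j = u \<otimes> S j \<oplus> c j n \<otimes> S n"
      using u_c cjn Sj Sn by (intro a_comm m_closed)
    also have "u \<otimes> S j = (\<Oplus>i\<in>{..<n}. u \<otimes> (c j i \<otimes> xs i))"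
      unfolding S_def using u_c c_c xs jn by (intro finsum_rdistr) auto
    also have "c j n \<otimes> S n = (\<Oplus>i\<in>{..<n}. c j n \<otimes> (c n i \<otimes> xs i))"
      unfolding S_def using c_c xs jn by (intro finsum_rdistr) auto
    also have "(\<Oplus>i\<in>{..<n}. u \<otimes> (c j i \<otimes> xs i)) \<oplus> (\<Oplus>i\<in>{..<n}. c j n \<otimes> (c n i \<otimes> xs i))
        = (\<Oplus>i\<in>{..<n}. u \<otimes> (c j i \<otimes> xs i) \<oplus> c j n \<otimes> (c n i \<otimes> xs i))"
      using u_c c_c xs jn by (intro finsum_addf[symmetric]) auto
    also have "\<dots> = (\<Oplus>i\<in>{..<n}. d i \<otimes> xs i)"
      unfolding d_def using u_c c_c xs jn
      by (intro finsum_cong') (auto simp: l_distr m_assoc)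
    finally show ?thesis
      using module_spanI[OF d] by simp
  qed
  moreover have "u \<otimes> s \<in> B - q"
    using q_prime[OF u Suc.prems(2)] .
  moreover have "xs \<in> {..<n} \<rightarrow> carrier R"
    using xs by auto
  ultimately obtain t where t: "t \<in> B - q" and tx: "\<And>j. j < n \<Longrightarrow> t \<otimes> xs j = \<zero>"
    using Suc.IH by blast
  have tB: "t \<in> B" and t_c: "t \<in> carrier R"
    using t Bc by auto
  have "(t \<otimes> u) \<otimes> xs j = \<zero>" if "j \<le> n" for j
  proof (cases "j = n")
    case True
    have "S n \<in> module_span R q n xs"
      unfolding S_def using c_q by (intro module_spanI) auto
    have "t \<otimes> S n = \<zero>"
    proof (rule annihilates_span)
      show "xs \<in> {..<n} \<rightarrow> carrier R" "q \<subseteq> carrier R"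
        using xs qB Bc by auto
    qed (fact t_c central[OF tB] tx \<open>S n \<in> module_span R q n xs\<close>)+
    then show ?thesis
      using True ux t_c u_c xs[OF order_refl] by (simp add: m_assoc)
  next
    case False
    hence "j < n" using that by simp
    have "(t \<otimes> u) \<otimes> xs j = u \<otimes> (t \<otimes> xs j)"
      unfolding central[OF tB u_c] using t_c u_c xs[OF that] by (simp add: m_assoc)
    then show ?thesis
      using tx[OF \<open>j < n\<close>] u_c by simp
  qed
  then have "\<forall>j<Suc n. (t \<otimes> u) \<otimes> xs j = \<zero>"
    by (simp only: less_Suc_eq_le) blast
  then show ?case
    using q_prime[OF t u] by blast
qed

section \<open>Passing to even parts\<close>

lemma (in ring) finsum_in_additive_subgroup:
  assumes "additive_subgroup H R" "f \<in> I \<rightarrow> H"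
  shows "finsum R f I \<in> H"
proof (cases "finite I")
  case True
  then show ?thesis
    using assms(2)
  proof (induction I rule: finite_induct)
    case empty
    then show ?case
      using additive_subgroup.zero_closed[OF assms(1)] by simp
  next
    case (insert i I)
    have "f \<in> insert i I \<rightarrow> carrier R"
      using insert.prems additive_subgroup.a_Hcarr[OF assms(1)] by auto
    then show ?case
      using insert additive_subgroup.a_closed[OF assms(1)] by (auto simp: finsum_insert)
  qed
next
  case False
  then show ?thesis
    using additive_subgroup.zero_closed[OF assms(1)] by (simp add: finsum_infinite)
qed

context superring
begin

lemma even_carrier: "x \<in> R0 \<Longrightarrow> x \<in> carrier R"
  using additive_subgroup.a_Hcarr[OF even_additive_subgroup] .

lemma odd_carrier: "x \<in> R1 \<Longrightarrow> x \<in> carrier R"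
  using additive_subgroup.a_Hcarr[OF odd_additive_subgroup] .

lemma even_subring: "subring R0 R"
proof (rule subringI)
  fix h assume "h \<in> R0"
  then show "\<ominus> h \<in> R0"
    using additive_subgroup.a_inv_closed[OF even_additive_subgroup] abelian_group_axioms by blast
qed (use even_carrier one_even even_even_mult
      additive_subgroup.a_closed[OF even_additive_subgroup] in auto)

lemma odd_subset_odd_ideal: "R1 \<subseteq> odd_ideal R R1"
proof
  fix x assume x: "x \<in> R1"
  then have "\<one> \<otimes> x \<in> odd_ideal R R1"
    unfolding odd_ideal_def by (intro ideal_prod.prod) auto
  then show "x \<in> odd_ideal R R1"
    using odd_carrier[OF x] by simp
qed

text \<open>
  Split the coefficients into even and odd parts: the odd parts contribute an odd element, which
  is a difference of even elements, hence zero.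
\<close>

lemma even_mem_span_even:
  assumes A: "subsuperring R R0 R1 A" and xs: "xs \<in> {..<n} \<rightarrow> R0"
    and m: "m \<in> module_span R A n xs" "m \<in> R0"
  shows "m \<in> module_span R (A \<inter> R0) n xs"
proof -
  interpret A: superring "R\<lparr>carrier := A\<rparr>" "A \<inter> R0" "A \<inter> R1"
    using A unfolding subsuperring_def by blast
  obtain a where a: "a \<in> {..<n} \<rightarrow> A" and m_eq: "m = (\<Oplus>i\<in>{..<n}. a i \<otimes> xs i)"
    using m(1) by (rule module_spanE)
  have "\<exists>b d. b \<in> A \<inter> R0 \<and> d \<in> A \<inter> R1 \<and> a i = b \<oplus> d" if "i < n" for i
  proof -
    have "a i \<in> (A \<inter> R0) <+>\<^bsub>R\<lparr>carrier := A\<rparr>\<^esub> (A \<inter> R1)"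
      unfolding A.parts_sum using a that by auto
    then show ?thesis
      by (auto simp: set_add_def set_mult_def)
  qed
  then obtain b d where b: "\<And>i. i < n \<Longrightarrow> b i \<in> A \<inter> R0" and d: "\<And>i. i < n \<Longrightarrow> d i \<in> A \<inter> R1"
    and a_eq: "\<And>i. i < n \<Longrightarrow> a i = b i \<oplus> d i"
    by metis
  have b_c: "b i \<in> carrier R" and d_c: "d i \<in> carrier R" and x_c: "xs i \<in> carrier R"
    if "i < n" for i
    using b[OF that] d[OF that] xs that even_carrier odd_carrier by auto
  define E where "E = (\<Oplus>i\<in>{..<n}. b i \<otimes> xs i)"
  define D where "D = (\<Oplus>i\<in>{..<n}. d i \<otimes> xs i)"
  have "m = (\<Oplus>i\<in>{..<n}. b i \<otimes> xs i \<oplus> d i \<otimes> xs i)"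
    unfolding m_eq using b_c d_c x_c a_eq by (intro finsum_cong') (auto simp: l_distr)
  also have "\<dots> = E \<oplus> D"
    unfolding E_def D_def using b_c d_c x_c by (intro finsum_addf) auto
  finally have mED: "m = E \<oplus> D" .
  have E: "E \<in> R0"
    unfolding E_def using b xs even_even_mult
    by (intro finsum_in_additive_subgroup[OF even_additive_subgroup]) auto
  have D: "D \<in> R1"
    unfolding D_def using d xs odd_even_mult
    by (intro finsum_in_additive_subgroup[OF odd_additive_subgroup]) auto
  have "D = m \<ominus> E"
    unfolding mED using even_carrier[OF E] odd_carrier[OF D] by algebra
  hence "D \<in> R0"
    unfolding minus_eq using m(2) E subringE(5,7)[OF even_subring] by auto
  hence "D = \<zero>"
    using D parts_inter by blast
  hence "m = E"
    using mED even_carrier[OF E] by simp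
  then show ?thesis
    unfolding E_def using b by (auto intro!: module_spanI)
qed

end

section \<open>Prime ideals of superrings\<close>

lemma super_prime_ideal_one_notin:
  assumes "super_prime_ideal \<pp> A"
  shows "\<one>\<^bsub>A\<^esub> \<notin> \<pp>"
proof
  interpret ideal \<pp> A
    using assms unfolding super_prime_ideal_def by blast
  interpret Q: domain "A Quot \<pp>"
    using assms unfolding super_prime_ideal_def by blast
  assume "\<one>\<^bsub>A\<^esub> \<in> \<pp>"
  then have "\<pp> +>\<^bsub>A\<^esub> \<one>\<^bsub>A\<^esub> = \<pp>"
    by (simp add: a_rcos_const)
  then show False
    using Q.one_not_zero by (simp add: FactRing_def)
qed

text \<open>
  The ambient ring \<open>A\<close> may be noncommutative; primality is pulled back from the quotient along the
  ring homomorphism \<open>a \<mapsto> \<pp> + a\<close>.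
\<close>

lemma super_prime_ideal_prime:
  assumes "super_prime_ideal \<pp> A" and a: "a \<in> carrier A" and b: "b \<in> carrier A"
    and ab: "a \<otimes>\<^bsub>A\<^esub> b \<in> \<pp>"
  shows "a \<in> \<pp> \<or> b \<in> \<pp>"
proof -
  have Quot_zero: "\<zero>\<^bsub>A Quot \<pp>\<^esub> = \<pp>"
    by (simp add: FactRing_def)
  interpret ideal \<pp> A
    using assms unfolding super_prime_ideal_def by blast
  interpret Q: domain "A Quot \<pp>"
    using assms unfolding super_prime_ideal_def by blast
  interpret h: ring_hom_ring A "A Quot \<pp>" "(+>\<^bsub>A\<^esub>) \<pp>"
    by (rule rcos_ring_hom_ring)
  have "(\<pp> +>\<^bsub>A\<^esub> a) \<otimes>\<^bsub>A Quot \<pp>\<^esub> (\<pp> +>\<^bsub>A\<^esub> b) = \<zero>\<^bsub>A Quot \<pp>\<^esub>"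
    unfolding Quot_zero h.hom_mult[OF a b, symmetric] by (rule a_rcos_const[OF ab])
  then have "\<pp> +>\<^bsub>A\<^esub> a = \<pp> \<or> \<pp> +>\<^bsub>A\<^esub> b = \<pp>"
    using Q.integral h.hom_closed[OF a] h.hom_closed[OF b] Quot_zero by metis
  then show ?thesis
    using rcos_const_imp_mem a b by blast
qed

text \<open>
  Even elements are central, so \<open>A \<inter> R0\<close> is a commutative ring, in which primality has its usual
  elementwise meaning.
\<close>

lemma (in superring) even_part_primeideal:
  assumes A: "subsuperring R R0 R1 A" and \<pp>: "super_prime_ideal \<pp> (R\<lparr>carrier := A\<rparr>)"
  shows "primeideal (\<pp> \<inter> R0) (R\<lparr>carrier := A \<inter> R0\<rparr>)"
proof -
  have subA: "subring A R"
    using A unfolding subsuperring_def by blast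
  interpret \<pp>: ideal \<pp> "R\<lparr>carrier := A\<rparr>"
    using \<pp> unfolding super_prime_ideal_def by blast
  have sub: "subring (A \<inter> R0) R"
    using subring_inter[OF subA even_subring] .
  interpret B: cring "R\<lparr>carrier := A \<inter> R0\<rparr>"
    using subcringI[OF sub] subcring_iff[OF subringE(1)[OF sub]] even_central even_carrier by auto
  have \<pp>A: "\<pp> \<subseteq> A"
    using \<pp>.Icarr by auto
  have p_add: "a \<oplus> b \<in> \<pp>" if "a \<in> \<pp>" "b \<in> \<pp>" for a b
    using additive_subgroup.a_closed[OF \<pp>.additive_subgroup_axioms that] by simp
  have p_l: "a \<otimes> b \<in> \<pp>" "b \<otimes> a \<in> \<pp>" if "a \<in> A" "b \<in> \<pp>" for a b
    using \<pp>.I_l_closed[of b a] \<pp>.I_r_closed[of b a] that by auto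
  (* Additive inverses in the even part of A are computed in R; multiplying by the even element -1
     shows that they stay in the ideal. *)
  have minus_one: "\<ominus> \<one> \<in> A \<inter> R0"
    using subringE(3,5)[OF sub] by blast
  have p_neg: "\<ominus> a \<in> \<pp> \<inter> R0" if "a \<in> \<pp> \<inter> R0" for a
  proof -
    have "\<ominus> a = \<ominus> \<one> \<otimes> a"
      using that even_carrier by (simp add: l_minus)
    then show ?thesis
      using p_l(1)[of "\<ominus> \<one>" a] minus_one that even_even_mult[of "\<ominus> \<one>" a] by auto
  qed
  show ?thesis
  proof (rule primeidealI)
    show "ideal (\<pp> \<inter> R0) (R\<lparr>carrier := A \<inter> R0\<rparr>)"
    proof (rule idealI)
      show "subgroup (\<pp> \<inter> R0) (add_monoid (R\<lparr>carrier := A \<inter> R0\<rparr>))"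
      proof (rule group.subgroupI)
        show "group (add_monoid (R\<lparr>carrier := A \<inter> R0\<rparr>))"
          by (rule B.add.is_group)
        show "\<pp> \<inter> R0 \<noteq> {}"
          using additive_subgroup.zero_closed[OF \<pp>.additive_subgroup_axioms]
            subringE(2)[OF even_subring] by auto
        fix a assume a: "a \<in> \<pp> \<inter> R0"
        have "\<ominus>\<^bsub>R\<lparr>carrier := A \<inter> R0\<rparr>\<^esub> a = \<ominus> a"
        proof (rule B.minus_equality)
          show "\<ominus> a \<oplus>\<^bsub>R\<lparr>carrier := A \<inter> R0\<rparr>\<^esub> a = \<zero>\<^bsub>R\<lparr>carrier := A \<inter> R0\<rparr>\<^esub>"
            using a even_carrier by (simp add: l_neg)
        qed (use a p_neg[OF a] \<pp>A in auto)
        then show "inv\<^bsub>add_monoid (R\<lparr>carrier := A \<inter> R0\<rparr>)\<^esub> a \<in> \<pp> \<inter> R0"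
          using p_neg[OF a] unfolding a_inv_def by simp
      qed (use \<pp>A p_add subringE(7)[OF even_subring] in auto)
    qed (use B.ring_axioms p_l even_even_mult in auto)
    show "cring (R\<lparr>carrier := A \<inter> R0\<rparr>)"
      by (rule B.cring_axioms)
    show "carrier (R\<lparr>carrier := A \<inter> R0\<rparr>) \<noteq> \<pp> \<inter> R0"
      using super_prime_ideal_one_notin[OF \<pp>] subringE(3)[OF sub] by auto
    fix a b
    assume "a \<in> carrier (R\<lparr>carrier := A \<inter> R0\<rparr>)" "b \<in> carrier (R\<lparr>carrier := A \<inter> R0\<rparr>)"
      "a \<otimes>\<^bsub>R\<lparr>carrier := A \<inter> R0\<rparr>\<^esub> b \<in> \<pp> \<inter> R0"
    then show "a \<in> \<pp> \<inter> R0 \<or> b \<in> \<pp> \<inter> R0"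
      using super_prime_ideal_prime[OF \<pp>, of a b] by auto
  qed
qed

section \<open>Valuation pairs are integrally closed\<close>

context superring
begin

text \<open>
  Every homogeneous element of \<open>A\<close> stabilises the module \<open>M = A\<close> generated by \<open>\<one>\<close>, and \<open>A\<close>
  contains the homogeneous components of its elements because it is graded.
\<close>

lemma subset_integral_closure:
  assumes A: "subsuperring R R0 R1 A"
  shows "A \<subseteq> integral_closure R R0 R1 A"
proof
  fix x assume x: "x \<in> A"
  have subA: "subring A R"
    using A unfolding subsuperring_def by blast
  interpret A: superring "R\<lparr>carrier := A\<rparr>" "A \<inter> R0" "A \<inter> R1"
    using A unfolding subsuperring_def by blast
  have Ac: "A \<subseteq> carrier R"
    using subringE(1)[OF subA] .
  have span: "module_span R A 1 (\<lambda>_. \<one>) = A"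
  proof (intro equalityI subsetI)
    fix m assume "m \<in> module_span R A 1 (\<lambda>_. \<one>)"
    then obtain a where "a \<in> {..<1} \<rightarrow> A" "m = (\<Oplus>i\<in>{..<1::nat}. a i \<otimes> \<one>)"
      by (rule module_spanE)
    then show "m \<in> A"
      using Ac by (auto simp: lessThan_Suc subset_iff)
  next
    fix m assume m: "m \<in> A"
    then have "(\<Oplus>i\<in>{..<1::nat}. m \<otimes> \<one>) \<in> module_span R A 1 (\<lambda>_. \<one>)"
      by (intro module_spanI) auto
    then show "m \<in> module_span R A 1 (\<lambda>_. \<one>)"
      using m Ac by (auto simp: lessThan_Suc subset_iff)
  qed
  have hom: "homogeneous_integral R R0 R1 A y" if y: "y \<in> A" "y \<in> R0 \<union> R1" for y
    unfolding homogeneous_integral_def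
  proof (intro conjI exI)
    show "\<forall>i<1::nat. \<one> \<in> R0 \<inter> ring_center R"
      using one_even by (auto simp: ring_center_def)
    show "A = module_span R A 1 (\<lambda>_. \<one>)"
      by (simp only: span)
    show "\<forall>m\<in>A. y \<otimes> m \<in> A"
      using y subringE(6)[OF subA] by blast
  qed (use y subringE(3)[OF subA] in auto)
  have "x \<in> (A \<inter> R0) <+>\<^bsub>R\<lparr>carrier := A\<rparr>\<^esub> (A \<inter> R1)"
    unfolding A.parts_sum using x by simp
  then obtain x0 x1 where "x0 \<in> A \<inter> R0" "x1 \<in> A \<inter> R1" "x = x0 \<oplus> x1"
    by (auto simp: set_add_def set_mult_def)
  then show "x \<in> integral_closure R R0 R1 A"
    using hom x Ac unfolding integral_closure_def integral_over_def by blast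
qed

text \<open>
  An element \<open>x \<notin> A\<close> has a multiple \<open>x x'\<close> in \<open>A - \<pp>\<close> with \<open>x' \<in> \<pp>\<close>. If \<open>x\<close> maps each
  generator of \<open>M\<close> into \<open>M\<close>, then \<open>x x'\<close> maps it to a combination with coefficients in \<open>\<pp>\<close>,
  which is the hypothesis of \<open>nakayama_annihilator\<close>. The annihilator obtained kills \<open>\<one> \<in> M\<close>.
\<close>

lemma even_integral_mem:
  assumes val: "valuation_pair R R0 R1 A \<pp>"
    and int: "homogeneous_integral R R0 R1 A x" and x: "x \<in> R0"
  shows "x \<in> A"
proof (rule ccontr)
  assume "x \<notin> A"
  have A: "subsuperring R R0 R1 A" and \<pp>: "super_prime_ideal \<pp> (R\<lparr>carrier := A\<rparr>)"
    using val unfolding valuation_pair_def by auto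
  have subA: "subring A R"
    using A unfolding subsuperring_def by blast
  interpret \<pp>: ideal \<pp> "R\<lparr>carrier := A\<rparr>"
    using \<pp> unfolding super_prime_ideal_def by blast
  define B where "B = A \<inter> R0"
  define q where "q = \<pp> \<inter> R0"
  have subB: "subring B R"
    unfolding B_def using subring_inter[OF subA even_subring] .
  have q: "primeideal q (R\<lparr>carrier := B\<rparr>)"
    unfolding q_def B_def using even_part_primeideal[OF A \<pp>] .
  have x_c: "x \<in> carrier R"
    using even_carrier[OF x] .
  obtain x' where x': "x' \<in> \<pp>" "x' \<in> R0" and y: "x \<otimes> x' \<in> A - \<pp>"
    using val \<open>x \<notin> A\<close> x_c unfolding valuation_pair_def by blast
  have x'_c: "x' \<in> carrier R"
    using even_carrier[OF x'(2)] .
  obtain n xs where xs: "\<And>i. i < n \<Longrightarrow> xs i \<in> R0"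
    and one: "\<one> \<in> module_span R A n xs"
    and stable: "\<And>m. m \<in> module_span R A n xs \<Longrightarrow> x \<otimes> m \<in> module_span R A n xs"
    using int unfolding homogeneous_integral_def by blast
  have xs_c: "xs \<in> {..<n} \<rightarrow> carrier R"
    using xs even_carrier by auto
  have rel: "(x \<otimes> x') \<otimes> xs j \<in> module_span R q n xs" if j: "j < n" for j
  proof -
    (* x times the generator is even, so it has an expansion with even coefficients; the factor x'
       then moves these coefficients into the prime ideal. *)
    have "x \<otimes> xs j \<in> module_span R A n xs"
      using stable generator_mem_span[OF _ _ xs_c j] subringE(2,3)[OF subA] by blast
    moreover have "x \<otimes> xs j \<in> R0"
      using x xs[OF j] even_even_mult by blast
    ultimately have "x \<otimes> xs j \<in> module_span R B n xs"
      unfolding B_def using even_mem_span_even[OF A] xs by (auto simp: Pi_def)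
    then obtain b where b: "b \<in> {..<n} \<rightarrow> B" and xx: "x \<otimes> xs j = (\<Oplus>i\<in>{..<n}. b i \<otimes> xs i)"
      by (rule module_spanE)
    have b_c: "b i \<in> carrier R" if "i < n" for i
      using b that subringE(1)[OF subB] by auto
    have "(x \<otimes> x') \<otimes> xs j = x' \<otimes> (x \<otimes> xs j)"
      unfolding even_central[OF x x'_c] using x_c x'_c xs[OF j] even_carrier by (simp add: m_assoc)
    also have "\<dots> = (\<Oplus>i\<in>{..<n}. x' \<otimes> (b i \<otimes> xs i))"
      unfolding xx using x'_c b_c xs_c by (intro finsum_rdistr) auto
    also have "\<dots> = (\<Oplus>i\<in>{..<n}. (x' \<otimes> b i) \<otimes> xs i)"
      using x'_c b_c xs_c by (intro finsum_cong') (auto simp: m_assoc Pi_iff)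
    also have "\<dots> \<in> module_span R q n xs"
    proof (rule module_spanI)
      show "(\<lambda>i. x' \<otimes> b i) \<in> {..<n} \<rightarrow> q"
        using b x' \<pp>.I_r_closed[of x'] even_even_mult unfolding q_def B_def by (auto simp: Pi_iff)
    qed
    finally show ?thesis .
  qed
  have "x \<otimes> x' \<in> B - q"
    using y even_even_mult[OF x x'(2)] unfolding B_def q_def by blast
  moreover have central: "b \<otimes> z = z \<otimes> b" if "b \<in> B" "z \<in> carrier R" for b z
    using that even_central unfolding B_def by blast
  ultimately have "\<exists>t \<in> B - q. \<forall>j<n. t \<otimes> xs j = \<zero>"
    by (intro nakayama_annihilator[OF subB q _ xs_c _ rel])
  then obtain t where t: "t \<in> B - q" and tx: "\<And>j. j < n \<Longrightarrow> t \<otimes> xs j = \<zero>"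
    by blast
  have t_c: "t \<in> carrier R"
    using t subringE(1)[OF subB] by blast
  have "t \<otimes> \<one> = \<zero>"
  proof (rule annihilates_span)
    show "t \<otimes> z = z \<otimes> t" if "z \<in> carrier R" for z
      using central t that by blast
  qed (fact xs_c subringE(1)[OF subA] t_c tx one)+
  then have "t = \<zero>"
    using t_c by simp
  moreover have "\<zero> \<in> q"
    using additive_subgroup.zero_closed[OF \<pp>.additive_subgroup_axioms]
      subringE(2)[OF even_subring] unfolding q_def by simp
  ultimately show False
    using t by blast
qed

end

theorem proposition3p12:
  fixes R :: "('a, 'm) ring_scheme" and R0 R1 A \<pp> :: "'a set"
  assumes "superring R R0 R1"
    and "valuation_pair R R0 R1 A \<pp>"
  shows "integrally_closed R R0 R1 A"
proof -
  interpret superring R R0 R1 by (rule assms(1))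
  have A: "subsuperring R R0 R1 A" and \<pp>: "super_prime_ideal \<pp> (R\<lparr>carrier := A\<rparr>)"
    and "odd_ideal R R1 \<subseteq> \<pp>"
    using assms(2) unfolding valuation_pair_def by auto
  interpret \<pp>: ideal \<pp> "R\<lparr>carrier := A\<rparr>"
    using \<pp> unfolding super_prime_ideal_def by blast
  have odd: "R1 \<subseteq> A"
    using odd_subset_odd_ideal \<open>odd_ideal R R1 \<subseteq> \<pp>\<close> \<pp>.Icarr by auto
  have "integral_closure R R0 R1 A \<subseteq> A"
  proof
    fix x assume "x \<in> integral_closure R R0 R1 A"
    then obtain x0 x1 where x0: "x0 \<in> R0" "homogeneous_integral R R0 R1 A x0"
      and x1: "x1 \<in> R1" and x_eq: "x = x0 \<oplus>\<^bsub>R\<^esub> x1"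
      unfolding integral_closure_def integral_over_def by blast
    have "subring A R"
      using A unfolding subsuperring_def by blast
    moreover have "x0 \<in> A" "x1 \<in> A"
      using even_integral_mem[OF assms(2) x0(2,1)] x1 odd by auto
    ultimately show "x \<in> A"
      unfolding x_eq by (rule subringE(7))
  qed
  then show ?thesis
    using subset_integral_closure[OF A] unfolding integrally_closed_def by blast
qed

end
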